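(* Let $a$ and $m$ be positive integers with $\frac{a}{2}+1\leq m<\frac{2a}{3}+1$ (so $a\geq 4$), and let $R_2(m,a)$ denote the 2-color Rado number of $x_1+\cdots+x_{m-1}=ax_m$. If $a\equiv m-1\pmod 3$ then $R_2(m,a)=4$. If $a\not\equiv m-1\pmod 3$ then $R_2(m,a)=5$, except that $R_2(3,4)=10$, $R_2(4,5)=9$, and $R_2(m,a)=6$ when $10\leq a\leq 14$ and $m=a-4$.
   Context: The 2-color Rado number $R_2(m,a)$ of $x_1+\cdots+x_{m-1}=ax_m$ is the least positive integer $n$ such that for every coloring of $[n]=\{1,\dots,n\}$ with two colors there exist $x_1,\dots,x_m\in[n]$ (not necessarily distinct), all of the same color, satisfying the equation.
   Formalization: The condition a ≥ 4 is taken as a hypothesis: it does not follow from the inequalities, which also allow a = m = 2, where x_1 = 2x_2 has no finite 2-color Rado number and the claimed value 5 fails. *)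

theory Defs
  imports Complex_Main "HOL-Library.Extended_Nat" "HOL-Number_Theory.Cong"
begin

definition mono_solution :: "nat \<Rightarrow> nat \<Rightarrow> nat \<Rightarrow> (nat \<Rightarrow> bool) \<Rightarrow> (nat \<Rightarrow> nat) \<Rightarrow> bool" where
  "mono_solution m a n c x \<longleftrightarrow>
     (\<forall>i\<in>{1..m}. x i \<in> {1..n}) \<and>
     (\<forall>i\<in>{1..m}. \<forall>j\<in>{1..m}. c (x i) = c (x j)) \<and>
     (\<Sum>i=1..m-1. x i) = a * x m"

(* Colourings are total functions, but only their values on {1..n} matter.
   The value is infinity if some colouring of every {1..n} avoids solutions,
   so an equation with a numeral also asserts that such an n exists. *)
definition rado2 :: "nat \<Rightarrow> nat \<Rightarrow> enat" where
  "rado2 m a = Inf (enat ` {n. 0 < n \<and> (\<forall>c :: nat \<Rightarrow> bool. \<exists>x. mono_solution m a n c x)})"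

end

theory Submission
  imports Defs
begin

text \<open>
  Put \<open>k = m - 1\<close> and \<open>d = a - k\<close>, so that \<open>d \<le> k < 2 * d\<close>. Replacing some summands of the
  constant sum \<open>s + \<dots> + s\<close> (\<open>k\<close> terms) by larger values of the same colour solves the equation
  with \<open>x\<^sub>m = s\<close> as soon as the increments add up to \<open>d * s\<close>. In a solution-free colouring this
  forces \<open>1\<close> and \<open>4\<close> to have one colour and \<open>2\<close> the other, and in general also \<open>3\<close> to have the
  colour of \<open>2\<close>; then \<open>5\<close> cannot be coloured as soon as \<open>d\<close> is a sum of threes and fours.
  Conversely, colouring \<open>2\<close> and \<open>3\<close> against the rest of \<open>{1..5}\<close> leaves only solutions with
  \<open>x\<^sub>m = 1\<close>, which write \<open>d\<close> as a sum of increments \<open>3\<close> and \<open>4\<close>.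
\<close>

section \<open>Tools for upper and lower bounds\<close>

lemma mono_solution_mono:
  assumes "mono_solution m a n c x" "n \<le> n'"
  shows "mono_solution m a n' c x"
  using assms unfolding mono_solution_def by fastforce

text \<open>A colouring without solutions up to \<open>n\<close> has none up to any smaller bound,
  so a single \<open>c\<close> rules out every candidate below \<open>Suc n\<close>.\<close>

lemma rado2_eqI:
  assumes upper: "\<And>c. \<exists>x. mono_solution m a (Suc n) c x"
    and lower: "\<And>x. \<not> mono_solution m a n c x"
  shows "rado2 m a = enat (Suc n)"
  unfolding rado2_def
proof (rule antisym)
  show "Inf (enat ` {n. 0 < n \<and> (\<forall>c. \<exists>x. mono_solution m a n c x)}) \<le> enat (Suc n)"
    using upper by (intro Inf_lower) blast
  show "enat (Suc n) \<le> Inf (enat ` {n. 0 < n \<and> (\<forall>c. \<exists>x. mono_solution m a n c x)})"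
  proof (rule Inf_greatest, clarify)
    fix n' assume "\<forall>c. \<exists>x. mono_solution m a n' c x"
    then obtain x where "mono_solution m a n' c x" by blast
    with lower mono_solution_mono have "\<not> n' \<le> n" by blast
    then show "enat (Suc n) \<le> enat n'" by simp
  qed
qed

lemma mono_solution_SucD:
  assumes "mono_solution (Suc k) a n c x"
  shows "x (Suc k) \<in> {1..n}" "\<And>i. i \<in> {1..k} \<Longrightarrow> x i \<in> {1..n} \<and> c (x i) = c (x (Suc k))"
    "(\<Sum>i=1..k. x i) = a * x (Suc k)"
  using assms unfolding mono_solution_def by auto

text \<open>Three distinct summand values, \<open>p\<close> times \<open>t\<close>, \<open>q\<close>
  times \<open>u\<close> and otherwise \<open>s\<close>, suffice for every upper bound
  below.\<close>

lemma mono_solutionI: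
  fixes s t u y :: nat
  assumes range: "{s, t, u, y} \<subseteq> {1..n}"
    and colour: "c s = c y" "c t = c y" "c u = c y"
    and pq: "p + q \<le> k"
    and eq: "(k - (p + q)) * s + p * t + q * u = a * y"
  shows "\<exists>x. mono_solution (Suc k) a n c x"
proof -
  define x where "x i = (if i = Suc k then y else if i \<le> p then t else if i \<le> p + q then u else s)"
    for i
  have split: "{1..k} = {1..p} \<union> {p+1..p+q} \<union> {p+q+1..k}"
    using pq by auto
  have "(\<Sum>i=1..k. x i) = (\<Sum>i=1..p. x i) + (\<Sum>i=p+1..p+q. x i) + (\<Sum>i=p+q+1..k. x i)"
    unfolding split by (subst sum.union_disjoint; (subst sum.union_disjoint)?) auto
  also have "(\<Sum>i=1..p. x i) = (\<Sum>i=1..p. t)"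
    using pq by (intro sum.cong) (auto simp: x_def)
  also have "(\<Sum>i=p+1..p+q. x i) = (\<Sum>i=p+1..p+q. u)"
    using pq by (intro sum.cong) (auto simp: x_def)
  also have "(\<Sum>i=p+q+1..k. x i) = (\<Sum>i=p+q+1..k. s)"
    using pq by (intro sum.cong) (auto simp: x_def)
  finally have "(\<Sum>i=1..k. x i) = a * y" using eq by simp
  moreover have "x i \<in> {1..n} \<and> c (x i) = c y" for i
    using range colour by (auto simp: x_def)
  moreover have "x (Suc k) = y" by (simp add: x_def)
  ultimately have "mono_solution (Suc k) a n c x"
    unfolding mono_solution_def by simp
  then show ?thesis by blast
qed

lemma mono_solution_incrementI:
  fixes s e f :: nat
  assumes "{s, s + e, s + f} \<subseteq> {1..n}" "c (s + e) = c s" "c (s + f) = c s"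
    and pq: "p + q \<le> k" "p * e + q * f = d * s"
  shows "\<exists>x. mono_solution (Suc k) (k + d) n c x"
proof (rule mono_solutionI[where s = s and y = s and p = p and q = q])
  obtain r where "k = p + q + r" using pq(1) le_Suc_ex by blast
  then show "(k - (p + q)) * s + p * (s + e) + q * (s + f) = (k + d) * s"
    using pq(2) by (simp add: algebra_simps)
qed (use assms in auto)

text \<open>For last value 2 or 3 the left side is at most \<open>3 * k < 2 * (k + d)\<close>; for 4
  or 5 it is at most \<open>5 * k < 4 * (k + d)\<close>. With last value 1, subtracting 1 from each
  summand leaves increments with sum \<open>d\<close>. The bound \<open>g i < n\<close> discards the
  increments that a smaller \<open>n\<close> cannot reach.\<close>

lemma not_mono_solution_two_three:
  assumes dk: "k < 2 * d" and n: "n \<le> 5"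
    and incr: "\<And>g :: nat \<Rightarrow> nat. (\<And>i. i \<in> {1..k} \<Longrightarrow> g i \<in> {0, 3, 4} \<and> g i < n) \<Longrightarrow> (\<Sum>i=1..k. g i) \<noteq> d"
  shows "\<not> mono_solution (Suc k) (k + d) n (\<lambda>v. v \<in> {2, 3}) x"
proof
  assume "mono_solution (Suc k) (k + d) n (\<lambda>v. v \<in> {2, 3}) x"
  note sol = mono_solution_SucD[OF this]
  have le: "(\<Sum>i=1..k. x i) \<le> k * b" if "\<And>i. i \<in> {1..k} \<Longrightarrow> x i \<le> b" for b
    using sum_bounded_above[of "{1..k}" x b] that by simp
  have ge: "(k + d) * b \<le> (\<Sum>i=1..k. x i)" if "b \<le> x (Suc k)" for b
    using sol(3) that by simp
  consider "x (Suc k) \<in> {2, 3}" | "x (Suc k) \<in> {4, 5}" | "x (Suc k) = 1"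
    using sol(1) n by fastforce
  then show False
  proof cases
    case 1
    then show False using le[of 3] ge[of 2] sol(2) dk by force
  next
    case 2
    have "x i \<le> 5" if "i \<in> {1..k}" for i using sol(2)[OF that] n by auto
    then show False using 2 le[of 5] ge[of 4] dk by force
  next
    case 3
    have x: "x i \<in> {1, 4, 5} \<and> x i \<le> n" if "i \<in> {1..k}" for i
      using sol(2)[OF that] 3 n by auto
    have "(\<Sum>i=1..k. x i) = (\<Sum>i=1..k. (x i - 1) + 1)"
      using x by (intro sum.cong) fastforce+
    also have "\<dots> = (\<Sum>i=1..k. x i - 1) + k" by (simp add: sum.distrib del: One_nat_def)
    finally have "(\<Sum>i=1..k. x i - 1) = d" using sol(3) 3 by simp
    moreover have "(\<Sum>i=1..k. x i - 1) \<noteq> d"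
    proof (rule incr)
      fix i assume "i \<in> {1..k}"
      from x[OF this] show "x i - 1 \<in> {0, 3, 4} \<and> x i - 1 < n" by auto
    qed
    ultimately show False by contradiction
  qed
qed

text \<open>These are the gaps of the numerical semigroup generated by 3 and 4. The induction needs
  them together: 5 is excluded because 5 - 3 and 5 - 4 are.\<close>

lemma sum_three_four_neq:
  fixes g :: "'a \<Rightarrow> nat"
  assumes "finite A" "\<And>i. i \<in> A \<Longrightarrow> g i \<in> {0, 3, 4}"
  shows "sum g A \<notin> {1, 2, 5}"
  using assms by (induction A rule: finite_induct) fastforce+

section \<open>Forced colours of 2, 3, 4 and 5\<close>

lemma colours_one_two_four:
  assumes sol: "\<nexists>x. mono_solution (Suc k) (k + d) n c x" and dk: "d \<le> k" and n: "4 \<le> n"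
  shows "c 1 \<noteq> c 2" "c 4 = c 1"
proof -
  show 12: "c 1 \<noteq> c 2"
    using mono_solution_incrementI[where s = 1 and e = 1 and f = 1 and p = d and q = 0 and c = c and n = n]
      sol dk n by (auto simp: numeral_2_eq_2)
  have "c 4 \<noteq> c 2"
    using mono_solution_incrementI[where s = 2 and e = 2 and f = 2 and p = d and q = 0 and c = c and n = n]
      sol dk n by auto
  with 12 show "c 4 = c 1" by auto
qed

lemma colour_three:
  assumes sol: "\<nexists>x. mono_solution (Suc k) (k + d) n c x" and dk: "d \<le> k" and n: "4 \<le> n"
    and d: "2 \<le> d"
  shows "c 3 = c 2"
proof (rule ccontr)
  note c = colours_one_two_four[OF sol dk n]
  assume "c 3 \<noteq> c 2"
  then have c3: "c 3 = c 1" using c by auto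
  \<comment> \<open>Now 1, 3 and 4 share a colour, which allows increments 2 and 3 on base 1; an odd
    \<open>d\<close> takes a single 3.\<close>
  obtain p q where "p + q \<le> d" "p * 2 + q * 3 = d"
  proof (cases "even d")
    case True
    then show ?thesis using that[of "d div 2" 0] by simp
  next
    case False
    then obtain e where "d = 2 * e + 1" by (rule oddE)
    then show ?thesis using that[of "e - 1" 1] d by simp
  qed
  then show False
    using mono_solution_incrementI[where s = 1 and e = 2 and f = 3 and p = p and q = q and c = c and n = n
        and k = k and d = d]
      sol dk n c c3 by (auto simp: numeral_eq_Suc)
qed

lemma colour_five:
  assumes sol: "\<nexists>x. mono_solution (Suc k) (k + d) n c x" and dk: "d \<le> k" and n: "5 \<le> n"
    and d: "4 \<le> d"
  shows "c 5 = c 1"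
proof (rule ccontr)
  have n4: "4 \<le> n" using n by simp
  note c = colours_one_two_four[OF sol dk n4]
  assume "c 5 \<noteq> c 1"
  moreover have "c 3 = c 2" using colour_three[OF sol dk n4] d by simp
  \<comment> \<open>With 2, 3 and 5 of one colour, \<open>2 * d\<close> is split greedily into
    threes and ones. The number of terms is at most \<open>(2 * d + 4) / 3\<close>, which is at most
    \<open>d\<close> once \<open>d\<close> is at least 4.\<close>
  moreover have "2 * d mod 3 + 2 * d div 3 \<le> k"
    using dk d div_mult_mod_eq[of "2 * d" 3] mod_less_divisor[of 3 "2 * d"] by linarith
  ultimately show False
    using mono_solution_incrementI[where s = 2 and e = 1 and f = 3 and c = c and n = n
        and p = "2 * d mod 3" and q = "2 * d div 3"] sol n c by auto
qed

section \<open>The values 4, 5 and 6\<close>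

lemma rado2_dvd:
  assumes "0 < d" "d \<le> k" "k < 2 * d" "3 dvd d"
  shows "rado2 (Suc k) (k + d) = 4"
proof -
  have "\<exists>x. mono_solution (Suc k) (k + d) (Suc 3) c x" for c
  proof (rule ccontr)
    assume sol: "\<not> ?thesis"
    then have "c 4 = c 1" using colours_one_two_four assms(2) by simp
    then show False
      using mono_solution_incrementI[where s = 1 and e = 3 and f = 3 and p = "d div 3" and q = 0
          and c = c and n = 4] sol assms by auto
  qed
  \<comment> \<open>Below 4 the colour class of 1 is \<open>{1}\<close>, so only increment 0
    remains.\<close>
  moreover have "\<not> mono_solution (Suc k) (k + d) 3 (\<lambda>v. v \<in> {2, 3}) x" for x
  proof (rule not_mono_solution_two_three)
    fix g :: "nat \<Rightarrow> nat"
    assume "\<And>i. i \<in> {1..k} \<Longrightarrow> g i \<in> {0, 3, 4} \<and> g i < 3"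
    then have "(\<Sum>i=1..k. g i) = 0" by fastforce
    then show "(\<Sum>i=1..k. g i) \<noteq> d" using assms(1) by simp
  qed (use assms in auto)
  ultimately have "rado2 (Suc k) (k + d) = enat (Suc 3)" by (rule rado2_eqI)
  then show ?thesis by (simp add: numeral_eq_enat)
qed

text \<open>The residue of \<open>d\<close> modulo 3 is the number of fours to use.\<close>

lemma sum_threes_and_fours:
  fixes d :: nat
  assumes "d \<notin> {1, 2, 5}"
  obtains p q where "p * 3 + q * 4 = d"
proof -
  have "d mod 3 = 0 \<or> d mod 3 = 1 \<and> 4 \<le> d \<or> d mod 3 = 2 \<and> 8 \<le> d"
    using assms unfolding insert_iff empty_iff by presburger
  then consider "d mod 3 = 0" | "d mod 3 = 1" "4 \<le> d" | "d mod 3 = 2" "8 \<le> d" by auto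
  then show thesis
  proof cases
    case 1
    then have "d div 3 * 3 + 0 * 4 = d" by presburger
    then show thesis by (rule that)
  next
    case 2
    then have "(d - 4) div 3 * 3 + 1 * 4 = d" by presburger
    then show thesis by (rule that)
  next
    case 3
    then have "(d - 8) div 3 * 3 + 2 * 4 = d" by presburger
    then show thesis by (rule that)
  qed
qed

text \<open>Up to 4 the only positive increment is 3, whose multiples miss \<open>d\<close>; the
  value 5 adds increment 4, and \<open>d\<close> is then no gap of the semigroup.\<close>

lemma rado2_not_dvd:
  assumes "4 \<le> d" "d \<le> k" "k < 2 * d" "\<not> 3 dvd d" "d \<noteq> 5"
  shows "rado2 (Suc k) (k + d) = 5"
proof -
  have "\<exists>x. mono_solution (Suc k) (k + d) (Suc 4) c x" for c
  proof (rule ccontr)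
    assume "\<not> ?thesis"
    then have sol: "\<nexists>x. mono_solution (Suc k) (k + d) 5 c x" by simp
    then have c: "c 4 = c 1" "c 5 = c 1"
      using colours_one_two_four colour_five assms(1,2) by auto
    obtain p q where "p * 3 + q * 4 = d"
      using sum_threes_and_fours[of d] assms by auto
    then show False
      using mono_solution_incrementI[where s = 1 and e = 3 and f = 4 and p = p and q = q
          and c = c and n = 5] sol assms c by auto
  qed
  moreover have "\<not> mono_solution (Suc k) (k + d) 4 (\<lambda>v. v \<in> {2, 3}) x" for x
  proof (rule not_mono_solution_two_three)
    fix g :: "nat \<Rightarrow> nat"
    assume "\<And>i. i \<in> {1..k} \<Longrightarrow> g i \<in> {0, 3, 4} \<and> g i < 4"
    then have "3 dvd (\<Sum>i=1..k. g i)" by (intro dvd_sum) fastforce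
    then show "(\<Sum>i=1..k. g i) \<noteq> d" using assms(4) by auto
  qed (use assms in auto)
  ultimately have "rado2 (Suc k) (k + d) = enat (Suc 4)" by (rule rado2_eqI)
  then show ?thesis by (simp add: numeral_eq_enat)
qed

text \<open>Since 5 is a gap, the colouring survives on \<open>{1..5}\<close>. The value 6 fits
  neither class: one increment 5 on base 1, or \<open>2 * 1 + 2 * 4 = 5 * 2\<close> on base
  2.\<close>

lemma rado2_five:
  assumes "5 \<le> k" "k < 10"
  shows "rado2 (Suc k) (k + 5) = 6"
proof -
  have "\<exists>x. mono_solution (Suc k) (k + 5) (Suc 5) c x" for c
  proof (rule ccontr)
    assume "\<not> ?thesis"
    then have sol: "\<nexists>x. mono_solution (Suc k) (k + 5) 6 c x" by simp
    have c: "c 1 \<noteq> c 2" "c 3 = c 2"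
      using colours_one_two_four[OF sol] colour_three[OF sol] assms by auto
    have "c 6 \<noteq> c 1"
      using mono_solution_incrementI[where s = 1 and e = 5 and f = 5 and p = 1 and q = 0
          and c = c and n = 6 and d = 5 and k = k] sol assms by auto
    moreover have "c 6 \<noteq> c 2"
      using mono_solution_incrementI[where s = 2 and e = 1 and f = 4 and p = 2 and q = 2
          and c = c and n = 6 and d = 5 and k = k] sol assms c by auto
    ultimately show False using c by auto
  qed
  moreover have "\<not> mono_solution (Suc k) (k + 5) 5 (\<lambda>v. v \<in> {2, 3}) x" for x
  proof (rule not_mono_solution_two_three)
    fix g :: "nat \<Rightarrow> nat"
    assume "\<And>i. i \<in> {1..k} \<Longrightarrow> g i \<in> {0, 3, 4} \<and> g i < 5"
    then show "(\<Sum>i=1..k. g i) \<noteq> 5" using sum_three_four_neq[of "{1..k}" g] by auto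
  qed (use assms in auto)
  ultimately have "rado2 (Suc k) (k + 5) = enat (Suc 5)" by (rule rado2_eqI)
  then show ?thesis by (simp add: numeral_eq_enat)
qed

section \<open>The two sporadic equations\<close>

lemma rado2_3_4: "rado2 3 4 = 10"
proof -
  have "\<exists>x. mono_solution (Suc 2) 4 (Suc 9) c x" for c
  proof (rule ccontr)
    assume sol: "\<not> ?thesis"
    have no: "\<not> (c x = c z \<and> c y = c z)"
      if "x + y = 4 * z" "{x, y, z} \<subseteq> {1..10}" for x y z
      using mono_solutionI[where p = 1 and q = 1 and s = x and t = x and u = y and y = z
          and n = "Suc 9" and c = c and a = 4 and k = 2] sol that by auto
    \<comment> \<open>The first five instances give 2 and 3 one colour and 1, 4, 5 and 6 the other;
      the rest leave no colour for 10.\<close>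
    show False
      using no[of 2 2 1] no[of 1 3 1] no[of 4 4 2] no[of 2 6 2] no[of 3 5 2] no[of 10 10 5]
        no[of 2 10 3] no[of 6 10 4] by auto
  qed
  moreover have "\<not> mono_solution (Suc 2) 4 9 (\<lambda>v. v \<in> {2, 3, 7, 8}) x" for x
  proof
    assume "mono_solution (Suc 2) 4 9 (\<lambda>v. v \<in> {2, 3, 7, 8}) x"
    note sol = mono_solution_SucD[OF this]
    have eq: "x 1 + x 2 = 4 * x 3" using sol(3) by (simp add: numeral_eq_Suc)
    have x3: "x (Suc 2) = x 3" by (simp add: numeral_3_eq_3)
    have x: "x i \<in> {1..9}" "x i \<in> {2, 3, 7, 8} \<longleftrightarrow> x 3 \<in> {2, 3, 7, 8}" if "i \<in> {1, 2}" for i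
      using sol(2)[of i] that unfolding x3 by auto
    have x': "x i \<in> (if x 3 \<in> {2, 3, 7, 8} then {2, 3, 7, 8} else {1, 4, 5, 6, 9})"
      if "i \<in> {1, 2}" for i
      using x[OF that] by (simp split: if_splits) presburger+
    \<comment> \<open>Two summands up to 9 stay below \<open>4 * 5\<close>; the remaining cases are
      checked by enumeration.\<close>
    have "x 3 \<in> {1, 2, 3, 4}" using eq x(1)[of 1] x(1)[of 2] sol(1) unfolding x3 by auto
    then show False using eq x'[of 1] x'[of 2] by auto
  qed
  ultimately have "rado2 (Suc 2) 4 = enat (Suc 9)" by (rule rado2_eqI)
  then show ?thesis by (simp add: numeral_eq_enat)
qed

lemma rado2_4_5: "rado2 4 5 = 9"
proof -
  have "\<exists>x. mono_solution (Suc 3) 5 (Suc 8) c x" for c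
  proof (rule ccontr)
    assume sol: "\<not> ?thesis"
    have no: "\<not> (c x = c z \<and> c y = c z \<and> c w = c z)"
      if "x + y + w = 5 * z" "{x, y, w, z} \<subseteq> {1..9}" for x y w z
      using mono_solutionI[where p = 1 and q = 1 and s = x and t = y and u = w and y = z
          and n = "Suc 8" and c = c and a = 5 and k = 3] sol that by auto
    \<comment> \<open>Again 2 and 3 are forced against 1, 4, 5 and 6, and the last two instances
      leave no colour for 9.\<close>
    show False
      using no[of 1 2 2 1] no[of 1 1 3 1] no[of 2 4 4 2] no[of 2 3 5 2] no[of 2 2 6 2]
        no[of 5 6 9 4] no[of 3 3 9 3] by auto
  qed
  moreover have "\<not> mono_solution (Suc 3) 5 8 (\<lambda>v. v \<in> {2, 3, 7, 8}) x" for x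
  proof
    assume "mono_solution (Suc 3) 5 8 (\<lambda>v. v \<in> {2, 3, 7, 8}) x"
    note sol = mono_solution_SucD[OF this]
    have eq: "x 1 + x 2 + x 3 = 5 * x 4" using sol(3) by (simp add: numeral_eq_Suc)
    have x4: "x (Suc 3) = x 4" by (simp add: eval_nat_numeral)
    have x: "x i \<in> {1..8}" "x i \<in> {2, 3, 7, 8} \<longleftrightarrow> x 4 \<in> {2, 3, 7, 8}" if "i \<in> {1, 2, 3}" for i
      using sol(2)[of i] that unfolding x4 by auto
    have x': "x i \<in> (if x 4 \<in> {2, 3, 7, 8} then {2, 3, 7, 8} else {1, 4, 5, 6})"
      if "i \<in> {1, 2, 3}" for i
      using x[OF that] by (simp split: if_splits) presburger+
    have "x 4 \<in> {1, 2, 3, 4}"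
      using eq x(1)[of 1] x(1)[of 2] x(1)[of 3] sol(1) unfolding x4 by auto
    then show False using eq x'[of 1] x'[of 2] x'[of 3] by auto
  qed
  ultimately have "rado2 (Suc 3) 5 = enat (Suc 8)" by (rule rado2_eqI)
  then show ?thesis by (simp add: numeral_eq_enat)
qed

theorem theorem5:
  fixes a m :: nat
  assumes "0 < m"
    and "4 \<le> a"
    and "real a / 2 + 1 \<le> real m"
    and "real m < 2 * real a / 3 + 1"
  shows "([a = m - 1] (mod 3) \<longrightarrow> rado2 m a = 4) \<and>
         (\<not> [a = m - 1] (mod 3) \<longrightarrow>
            rado2 m a =
              (if m = 3 \<and> a = 4 then 10
               else if m = 4 \<and> a = 5 then 9
               else if 10 \<le> a \<and> a \<le> 14 \<and> m = a - 4 then 6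
               else 5))"
proof -
  define k d where "k = m - 1" and "d = a - k"
  have mk: "m = Suc k" using assms(1) by (simp add: k_def)
  have "k < a" "a \<le> 2 * k" "3 * k < 2 * a" using assms mk by linarith+
  then have ad: "a = k + d" and dk: "d \<le> k" "k < 2 * d" by (auto simp: d_def)
  \<comment> \<open>\<open>d = 1\<close> would force \<open>k = 1\<close> and
    \<open>a = 2\<close>.\<close>
  have d2: "2 \<le> d" using assms(2) ad dk by linarith
  have cong: "[a = m - 1] (mod 3) \<longleftrightarrow> 3 dvd d"
    using cong_add_lcancel_0_nat[of k d 3] by (simp add: mk ad cong_0_iff)
  consider "3 dvd d" | "\<not> 3 dvd d" "d = 2" | "\<not> 3 dvd d" "d = 5"
    | "\<not> 3 dvd d" "4 \<le> d" "d \<noteq> 5"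
  proof -
    have "d = 2 \<or> d = 3 \<or> 4 \<le> d" using d2 by linarith
    then show thesis using that by auto
  qed
  then show ?thesis
  proof cases
    case 1
    then show ?thesis using rado2_dvd[of d k] dk d2 cong mk ad by simp
  next
    case 2
    then have "k = 2 \<or> k = 3" using dk by auto
    then show ?thesis using 2 cong mk ad rado2_3_4 rado2_4_5 by auto
  next
    case 3
    then show ?thesis using cong mk ad dk rado2_five[of k] by auto
  next
    case 4
    \<comment> \<open>The first two exceptions have \<open>d = 2\<close>, and
      \<open>m = a - 4\<close> means \<open>d = 5\<close>.\<close>
    then have "\<not> (m = 3 \<and> a = 4)" "\<not> (m = 4 \<and> a = 5)" "m \<noteq> a - 4"
      using mk ad by auto
    then show ?thesis using 4 cong rado2_not_dvd[of d k] dk unfolding mk ad by auto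
  qed
qed

end
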